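(* Let $T=\{z\in\mathbb{C}:|z|=1\}$ and $T_0=T\cup\{0\}$, and let $\prec$ be a total ordering on $T_0$ with $\min(T_0)=1$ and $\max(T_0)=0$. Then every unit weighing matrix is equivalent to a unit weighing matrix that is in standard form.
   Context: $T_0^{m\times n}$ denotes the set of $m\times n$ matrices with entries in $T_0$. A matrix $W\in T_0^{n\times n}$ is a unit weighing matrix of order $n$ with weight $w$ if $WW^*=wI$, where $W^*$ is the conjugate transpose of $W$. Lexicographic order: for row vectors $a=(a_1,\dots,a_n)$ and $b=(b_1,\dots,b_n)$ with entries in $T_0$, if $k$ is the smallest index with $a_k\ne b_k$, write $a<b$ provided $a_k\prec b_k$; write $a\le b$ if $a<b$ or $a=b$. The rows $a_1,\dots,a_m$ of a matrix are in lexicographical order if $a_1\le a_2\le\cdots\le a_m$. Standard form: a matrix in $T_0^{m\times n}$ is in standard form if all of the following hold: (S1) the first non-zero entry in each row is $1$ (no condition on zero rows); (S2) the first non-zero entry in each column is $1$ (no condition on zero columns); (S3) the first row is ones followed by zeros, i.e. of the form $(1,\dots,1,0,\dots,0)$, where the number of ones and the number of zeros may each be $0$; (S4) the rows are in lexicographical order according to $\prec$. Monomial matrices: for $m\ge 1$, let $\mathbb{M}_m\subset T_0^{m\times m}$ be the set of products $PD$, where $P$ is an $m\times m$ permutation matrix and $D$ is a diagonal matrix with all diagonal entries in $T$. Equivalence: $A,B\in T_0^{m\times n}$ are equivalent if there exist $M_1\in\mathbb{M}_m$ and $M_2\in\mathbb{M}_n$ such that $M_1AM_2=B$. *)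

theory Defs
  imports "Jordan_Normal_Form.Schur_Decomposition"
begin

definition T :: "complex set" where
  "T = {z. cmod z = 1}"

definition T0 :: "complex set" where
  "T0 = T \<union> {0}"

definition T0_mat :: "nat \<Rightarrow> nat \<Rightarrow> complex mat set" where
  "T0_mat m n = {A \<in> carrier_mat m n. elements_mat A \<subseteq> T0}"

text \<open>The weight is an arbitrary scalar here; for positive order the equation forces it to be
  the number of non-zero entries in each row.\<close>

definition unit_weighing_mat :: "nat \<Rightarrow> complex \<Rightarrow> complex mat \<Rightarrow> bool" where
  "unit_weighing_mat n w W \<longleftrightarrow> W \<in> T0_mat n n \<and> W * mat_adjoint W = w \<cdot>\<^sub>m 1\<^sub>m n"

text \<open>The relation \<open>r\<close> is the strict order: \<open>(x, y) \<in> r\<close> stands for \<open>x \<prec> y\<close>.\<close>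

definition lex_less :: "complex rel \<Rightarrow> complex vec \<Rightarrow> complex vec \<Rightarrow> bool" where
  "lex_less r a b \<longleftrightarrow> dim_vec a = dim_vec b \<and>
     (\<exists>k < dim_vec a. (\<forall>j < k. a $ j = b $ j) \<and> a $ k \<noteq> b $ k \<and> (a $ k, b $ k) \<in> r)"

definition lex_le :: "complex rel \<Rightarrow> complex vec \<Rightarrow> complex vec \<Rightarrow> bool" where
  "lex_le r a b \<longleftrightarrow> lex_less r a b \<or> a = b"

definition first_nonzero_one :: "complex vec \<Rightarrow> bool" where
  "first_nonzero_one v \<longleftrightarrow>
     (\<forall>k < dim_vec v. v $ k \<noteq> 0 \<and> (\<forall>j < k. v $ j = 0) \<longrightarrow> v $ k = 1)"

definition ones_then_zeros :: "complex vec \<Rightarrow> bool" where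
  "ones_then_zeros v \<longleftrightarrow> (\<exists>k \<le> dim_vec v. v = vec (dim_vec v) (\<lambda>j. if j < k then 1 else 0))"

definition standard_form :: "complex rel \<Rightarrow> nat \<Rightarrow> nat \<Rightarrow> complex mat \<Rightarrow> bool" where
  "standard_form r m n A \<longleftrightarrow> A \<in> T0_mat m n \<and>
     (\<forall>i < m. first_nonzero_one (row A i)) \<and>
     (\<forall>j < n. first_nonzero_one (col A j)) \<and>
     (0 < m \<longrightarrow> ones_then_zeros (row A 0)) \<and>
     (\<forall>i. Suc i < m \<longrightarrow> lex_le r (row A i) (row A (Suc i)))"

definition perm_mats :: "nat \<Rightarrow> complex mat set" where
  "perm_mats m = {mat m m (\<lambda>(i, j). if p i = j then 1 else 0) | p. p permutes {..<m}}"

definition unit_diag_mats :: "nat \<Rightarrow> complex mat set" where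
  "unit_diag_mats m = {D \<in> carrier_mat m m. diagonal_mat D \<and> (\<forall>i < m. D $$ (i, i) \<in> T)}"

definition monomial_mats :: "nat \<Rightarrow> complex mat set" where
  "monomial_mats m = {P * D | P D. P \<in> perm_mats m \<and> D \<in> unit_diag_mats m}"

definition equivalent_mats :: "nat \<Rightarrow> nat \<Rightarrow> complex mat \<Rightarrow> complex mat \<Rightarrow> bool" where
  "equivalent_mats m n A B \<longleftrightarrow> A \<in> T0_mat m n \<and> B \<in> T0_mat m n \<and>
     (\<exists>M1 \<in> monomial_mats m. \<exists>M2 \<in> monomial_mats n. M1 * A * M2 = B)"

end

theory Submission
  imports Defs
begin

text \<open>A matrix that is least, in the row-major lexicographic order, among all matrices obtained by
  permuting and rescaling rows and columns is in standard form: otherwise rescaling one row or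
  column, swapping two columns or swapping two adjacent rows would yield a smaller one. The orbit is
  infinite and the order on \<open>T0\<close> need not be a well-order, so the existence of a least
  element needs an argument. Fix the entries before a position. If the value 1 can be attained there,
  it is least. If not, each of the finitely many pairs of permutations allows at most one value.\<close>

section \<open>Arithmetic of unit complex numbers and entries in \<open>T0\<close>\<close>

lemma one_mem_T [simp]: "1 \<in> T"
  by (simp add: T_def)

lemma mult_mem_T [simp]: "x \<in> T \<Longrightarrow> y \<in> T \<Longrightarrow> x * y \<in> T"
  by (simp add: T_def norm_mult)

lemma cnj_mem_T [simp]: "x \<in> T \<Longrightarrow> cnj x \<in> T"
  by (simp add: T_def)

lemma mult_cnj_T [simp]: "x \<in> T \<Longrightarrow> x * cnj x = 1" "x \<in> T \<Longrightarrow> cnj x * x = 1"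
  by (simp_all add: T_def complex_norm_square [symmetric] mult.commute)

lemma T_nonzero: "x \<in> T \<Longrightarrow> x \<noteq> 0"
  by (auto simp: T_def)

lemma T0_cases: "x \<in> T0 \<Longrightarrow> x = 0 \<or> x \<in> T"
  by (auto simp: T0_def)

lemma T_subset_T0: "T \<subseteq> T0"
  by (auto simp: T0_def)

lemma mult_mem_T0: "x \<in> T0 \<Longrightarrow> y \<in> T0 \<Longrightarrow> x * y \<in> T0"
  by (auto simp: T0_def)

lemma T0_mat_iff:
  "A \<in> T0_mat m n \<longleftrightarrow> A \<in> carrier_mat m n \<and> (\<forall>i<m. \<forall>j<n. A $$ (i, j) \<in> T0)"
  unfolding T0_mat_def elements_mat_def by (fastforce simp: subset_eq)

section \<open>Least elements and lexicographic minima\<close>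

lemma finite_strict_linear_order_least:
  assumes "strict_linear_order_on S r" "finite V" "V \<noteq> {}" "V \<subseteq> S"
  shows "\<exists>v\<in>V. \<forall>x\<in>V. v = x \<or> (v, x) \<in> r"
  using assms(2,3,4)
proof (induction V rule: finite_ne_induct)
  case (singleton x)
  then show ?case by simp
next
  case (insert x F)
  then obtain v where v: "v \<in> F" "\<forall>y\<in>F. v = y \<or> (v, y) \<in> r" by auto
  have tr: "trans r" and tot: "total_on S r"
    using assms(1) by (auto simp: strict_linear_order_on_def)
  have "v = x \<or> (v, x) \<in> r \<or> (x, v) \<in> r"
    using tot v(1) insert.prems by (auto simp: total_on_def)
  then show ?case
    using v transD[OF tr] by (metis insert_iff)
qed

text \<open>Positions are settled one after another: \<open>step\<close> improves position
  \<open>N\<close> while keeping all earlier entries. Minimality at an earlier position only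
  involves entries up to that position, so it passes from \<open>x\<close> to the improved
  \<open>y\<close>.\<close>

lemma lexicographic_min_exists:
  fixes f :: "'b \<Rightarrow> nat \<Rightarrow> 'a"
  assumes "X \<noteq> {}"
    and step: "\<And>p x. p < N \<Longrightarrow> x \<in> X \<Longrightarrow>
      \<exists>y\<in>X. (\<forall>q<p. f y q = f x q) \<and>
        (\<forall>z\<in>X. (\<forall>q<p. f z q = f x q) \<longrightarrow> f y p = f z p \<or> (f y p, f z p) \<in> r)"
  shows "\<exists>x\<in>X. \<forall>p<N. \<forall>z\<in>X. (\<forall>q<p. f z q = f x q) \<longrightarrow> f x p = f z p \<or> (f x p, f z p) \<in> r"
  using step
proof (induction N)
  case 0
  then show ?case using assms(1) by auto
next
  case (Suc N)
  have "\<exists>x\<in>X. \<forall>p<N. \<forall>z\<in>X. (\<forall>q<p. f z q = f x q) \<longrightarrow> f x p = f z p \<or> (f x p, f z p) \<in> r"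
    by (rule Suc.IH) (rule Suc.prems, simp_all)
  then obtain x where x: "x \<in> X"
    "\<forall>p<N. \<forall>z\<in>X. (\<forall>q<p. f z q = f x q) \<longrightarrow> f x p = f z p \<or> (f x p, f z p) \<in> r"
    by blast
  from Suc.prems[OF lessI x(1)] obtain y where y: "y \<in> X" "\<forall>q<N. f y q = f x q"
    "\<forall>z\<in>X. (\<forall>q<N. f z q = f x q) \<longrightarrow> f y N = f z N \<or> (f y N, f z N) \<in> r"
    by blast
  have "f y p = f z p \<or> (f y p, f z p) \<in> r"
    if "p < Suc N" "z \<in> X" "\<forall>q<p. f z q = f y q" for p z
  proof (cases "p = N")
    case True
    then show ?thesis using that y by simp
  next
    case False
    then have "p < N" using that by simp
    then have "\<forall>q<p. f z q = f x q" using that(3) y(2) by simp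
    then show ?thesis using x(2) y(2) \<open>p < N\<close> that(2) by metis
  qed
  then show ?case using y(1) by blast
qed

section \<open>The orbit under permuting and rescaling rows and columns\<close>

definition scaled_perm_mat ::
  "nat \<Rightarrow> nat \<Rightarrow> complex mat \<Rightarrow> (nat \<Rightarrow> nat) \<Rightarrow> (nat \<Rightarrow> nat) \<Rightarrow> (nat \<Rightarrow> complex) \<Rightarrow> (nat \<Rightarrow> complex)
    \<Rightarrow> complex mat" where
  "scaled_perm_mat m n A \<sigma> \<tau> d e = mat m n (\<lambda>(i, j). d i * A $$ (\<sigma> i, \<tau> j) * e j)"

text \<open>Requiring unit values on all of \<open>nat\<close> loses nothing, since values beyond
  the dimensions do not enter the matrix, and it spares index bounds later.\<close>

definition mat_orbit :: "nat \<Rightarrow> nat \<Rightarrow> complex mat \<Rightarrow> complex mat set" where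
  "mat_orbit m n A = {scaled_perm_mat m n A \<sigma> \<tau> d e | \<sigma> \<tau> d e.
     \<sigma> permutes {..<m} \<and> \<tau> permutes {..<n} \<and> range d \<subseteq> T \<and> range e \<subseteq> T}"

lemma scaled_perm_mat_index [simp]:
  "i < m \<Longrightarrow> j < n \<Longrightarrow> scaled_perm_mat m n A \<sigma> \<tau> d e $$ (i, j) = d i * A $$ (\<sigma> i, \<tau> j) * e j"
  by (simp add: scaled_perm_mat_def)

lemma scaled_perm_mat_dim [simp]:
  "scaled_perm_mat m n A \<sigma> \<tau> d e \<in> carrier_mat m n"
  "dim_row (scaled_perm_mat m n A \<sigma> \<tau> d e) = m"
  "dim_col (scaled_perm_mat m n A \<sigma> \<tau> d e) = n"
  by (simp_all add: scaled_perm_mat_def)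

lemma mat_orbit_refl: "A \<in> carrier_mat m n \<Longrightarrow> A \<in> mat_orbit m n A"
  unfolding mat_orbit_def
  by (rule CollectI, rule exI[of _ id], rule exI[of _ id], rule exI[of _ "\<lambda>_. 1"],
      rule exI[of _ "\<lambda>_. 1"]) (auto simp: permutes_id intro!: eq_matI)

lemma permutes_lessThan: "p permutes {..<m} \<Longrightarrow> i < m \<Longrightarrow> p i < m"
  using permutes_in_image by fastforce

lemma mat_orbit_T0_mat:
  assumes "A \<in> T0_mat m n" "B \<in> mat_orbit m n A"
  shows "B \<in> T0_mat m n"
proof -
  obtain \<sigma> \<tau> d e where B: "B = scaled_perm_mat m n A \<sigma> \<tau> d e"
    and *: "\<sigma> permutes {..<m}" "\<tau> permutes {..<n}" "range d \<subseteq> T" "range e \<subseteq> T"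
    using assms(2) by (auto simp: mat_orbit_def)
  have "d i \<in> T0" "e i \<in> T0" for i
    using * T_subset_T0 by auto
  then show ?thesis
    using assms(1) * by (auto simp: B T0_mat_iff permutes_lessThan intro!: mult_mem_T0)
qed

text \<open>Permutations compose and scalars multiply. This places every modification of a minimal
  matrix in the orbit over which it is minimal.\<close>

lemma mat_orbit_scaled_perm_mat:
  assumes "B \<in> mat_orbit m n A"
    and *: "\<sigma> permutes {..<m}" "\<tau> permutes {..<n}" "range d \<subseteq> T" "range e \<subseteq> T"
  shows "scaled_perm_mat m n B \<sigma> \<tau> d e \<in> mat_orbit m n A"
proof -
  obtain \<sigma>' \<tau>' d' e' where B: "B = scaled_perm_mat m n A \<sigma>' \<tau>' d' e'"
    and **: "\<sigma>' permutes {..<m}" "\<tau>' permutes {..<n}" "range d' \<subseteq> T" "range e' \<subseteq> T"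
    using assms(1) by (auto simp: mat_orbit_def)
  have "scaled_perm_mat m n B \<sigma> \<tau> d e =
      scaled_perm_mat m n A (\<sigma>' \<circ> \<sigma>) (\<tau>' \<circ> \<tau>) (\<lambda>i. d i * d' (\<sigma> i)) (\<lambda>j. e j * e' (\<tau> j))"
    using * by (auto intro!: eq_matI simp: B permutes_lessThan)
  moreover have "\<sigma>' \<circ> \<sigma> permutes {..<m}" "\<tau>' \<circ> \<tau> permutes {..<n}"
    using * ** by (auto intro: permutes_compose)
  moreover have "range (\<lambda>i. d i * d' (\<sigma> i)) \<subseteq> T" "range (\<lambda>j. e j * e' (\<tau> j)) \<subseteq> T"
    using * ** by (auto intro!: mult_mem_T)
  ultimately show ?thesis unfolding mat_orbit_def by blast
qed

section \<open>Orbit elements as products with monomial matrices\<close>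

lemma mult_mat_index_sum:
  assumes "A \<in> carrier_mat m k" "B \<in> carrier_mat k n" "i < m" "j < n"
  shows "(A * B) $$ (i, j) = (\<Sum>l<k. A $$ (i, l) * B $$ (l, j))"
  using assms by (auto simp: scalar_prod_def atLeast0LessThan)

text \<open>Right multiplication by a diagonal matrix scales columns, so in \<open>P * D\<close> the
  scalar is indexed by the column \<open>j\<close>.\<close>

lemma monomial_mats_intro:
  assumes p: "p permutes {..<m}" and d: "range d \<subseteq> T"
  shows "mat m m (\<lambda>(i, j). if p i = j then d j else 0) \<in> monomial_mats m"
proof -
  let ?P = "mat m m (\<lambda>(i, j). if p i = j then 1 else 0) :: complex mat"
  let ?D = "mat m m (\<lambda>(i, j). if i = j then d j else 0)"
  have "mat m m (\<lambda>(i, j). if p i = j then d j else 0) = ?P * ?D"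
  proof (rule eq_matI)
    fix i j assume "i < dim_row (?P * ?D)" "j < dim_col (?P * ?D)"
    then have ij: "i < m" "j < m" by auto
    have "(?P * ?D) $$ (i, j) = (\<Sum>l<m. ?P $$ (i, l) * ?D $$ (l, j))"
      using ij by (intro mult_mat_index_sum) auto
    also have "\<dots> = (\<Sum>l<m. if l = j then (if p i = j then d j else 0) else 0)"
      using ij by (intro sum.cong) auto
    finally show "mat m m (\<lambda>(i, j). if p i = j then d j else 0) $$ (i, j) = (?P * ?D) $$ (i, j)"
      using ij by simp
  qed auto
  moreover have "?P \<in> perm_mats m" using p by (auto simp: perm_mats_def)
  moreover have "?D \<in> unit_diag_mats m"
    using d by (auto simp: unit_diag_mats_def diagonal_mat_def)
  ultimately show ?thesis unfolding monomial_mats_def by blast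
qed

lemma mat_orbit_equivalent:
  assumes A: "A \<in> T0_mat m n" and B: "B \<in> mat_orbit m n A"
  shows "equivalent_mats m n A B"
proof -
  obtain \<sigma> \<tau> d e where B': "B = scaled_perm_mat m n A \<sigma> \<tau> d e"
    and *: "\<sigma> permutes {..<m}" "\<tau> permutes {..<n}" "range d \<subseteq> T" "range e \<subseteq> T"
    using B by (auto simp: mat_orbit_def)
  have dim: "dim_row A = m" "dim_col A = n" using A by (auto simp: T0_mat_iff)
  \<comment> \<open>The only non-zero entry of row \<open>i\<close> of \<open>M1\<close> lies in
    column \<open>\<sigma> i\<close>. Since scalars are indexed by columns, the inverse of
    \<open>\<sigma>\<close> is needed to put the row factor \<open>d i\<close> there. In
    \<open>M2\<close>, column \<open>j\<close> must pick out column \<open>\<tau> j\<close> of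
    \<open>A\<close>, so it is the permutation that is inverted.\<close>
  define M1 where "M1 = mat m m (\<lambda>(i, j). if \<sigma> i = j then d (inv_into UNIV \<sigma> j) else 0)"
  define M2 where "M2 = mat n n (\<lambda>(i, j). if inv_into UNIV \<tau> i = j then e j else 0)"
  have "M1 \<in> monomial_mats m" "M2 \<in> monomial_mats n"
    unfolding M1_def M2_def using *
    by (auto intro!: monomial_mats_intro[where d = "\<lambda>j. d (inv_into UNIV \<sigma> j)"] monomial_mats_intro permutes_inv)
  moreover have "M1 * A * M2 = B"
  proof (rule eq_matI)
    fix i j assume "i < dim_row B" "j < dim_col B"
    then have ij: "i < m" "j < n" by (auto simp: B')
    have M1A: "(M1 * A) $$ (i, l) = d i * A $$ (\<sigma> i, l)" if "l < n" for l
    proof -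
      have "(M1 * A) $$ (i, l) = (\<Sum>k<m. M1 $$ (i, k) * A $$ (k, l))"
        using that ij dim by (intro mult_mat_index_sum) (auto simp: M1_def)
      also have "\<dots> = (\<Sum>k<m. if k = \<sigma> i then d i * A $$ (k, l) else 0)"
        using ij * by (intro sum.cong) (auto simp: M1_def permutes_inverses)
      finally show ?thesis using ij * by (simp add: permutes_lessThan)
    qed
    have "(M1 * A * M2) $$ (i, j) = (\<Sum>l<n. (M1 * A) $$ (i, l) * M2 $$ (l, j))"
      using ij dim by (intro mult_mat_index_sum) (auto simp: M1_def M2_def)
    also have "\<dots> = (\<Sum>l<n. if l = \<tau> j then d i * A $$ (\<sigma> i, l) * e j else 0)"
      using ij * by (intro sum.cong) (auto simp: M1A M2_def permutes_inverses)
    also have "\<dots> = B $$ (i, j)"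
      using ij * by (simp add: B' permutes_lessThan)
    finally show "(M1 * A * M2) $$ (i, j) = B $$ (i, j)" .
  qed (auto simp: B' M1_def M2_def)
  ultimately show ?thesis
    using A mat_orbit_T0_mat[OF A B] by (auto simp: equivalent_mats_def)
qed

section \<open>Invariance of the weighing property\<close>

lemma mult_mat_adjoint_index:
  assumes "W \<in> carrier_mat n n" "i < n" "j < n"
  shows "(W * mat_adjoint W) $$ (i, j) = (\<Sum>l<n. W $$ (i, l) * cnj (W $$ (j, l)))"
  using assms by (auto simp: mat_adjoint_def scalar_prod_def mat_of_rows_def atLeast0LessThan)

text \<open>In the inner product of two rows the column scalars cancel and the column permutation
  only reorders the sum. The row operations conjugate a scalar matrix by a unitary one, which fixes
  it; hence the weight is unchanged.\<close>

lemma mat_orbit_unit_weighing: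
  assumes W: "unit_weighing_mat n w W" and B: "B \<in> mat_orbit n n W"
  shows "unit_weighing_mat n w B"
proof -
  have T0W: "W \<in> T0_mat n n" and WW: "W * mat_adjoint W = w \<cdot>\<^sub>m 1\<^sub>m n"
    using W by (auto simp: unit_weighing_mat_def)
  have W_c: "W \<in> carrier_mat n n" using T0W by (simp add: T0_mat_iff)
  obtain \<sigma> \<tau> d e where B': "B = scaled_perm_mat n n W \<sigma> \<tau> d e"
    and *: "\<sigma> permutes {..<n}" "\<tau> permutes {..<n}" "range d \<subseteq> T" "range e \<subseteq> T"
    using B by (auto simp: mat_orbit_def)
  have B_c: "B \<in> carrier_mat n n" by (simp add: B')
  have dT: "d i \<in> T" and eT: "e i \<in> T" for i using * by auto
  have "B * mat_adjoint B = w \<cdot>\<^sub>m 1\<^sub>m n"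
  proof (rule eq_matI)
    fix i j assume "i < dim_row (w \<cdot>\<^sub>m 1\<^sub>m n)" "j < dim_col (w \<cdot>\<^sub>m 1\<^sub>m n)"
    then have ij: "i < n" "j < n" by auto
    have "(B * mat_adjoint B) $$ (i, j) = (\<Sum>l<n. B $$ (i, l) * cnj (B $$ (j, l)))"
      by (rule mult_mat_adjoint_index[OF B_c ij])
    also have "\<dots> = (\<Sum>l<n. d i * cnj (d j) * (W $$ (\<sigma> i, \<tau> l) * cnj (W $$ (\<sigma> j, \<tau> l))))"
    proof (rule sum.cong)
      fix l assume "l \<in> {..<n}"
      then have "B $$ (i, l) * cnj (B $$ (j, l)) = d i * cnj (d j) *
          (W $$ (\<sigma> i, \<tau> l) * cnj (W $$ (\<sigma> j, \<tau> l))) * (e l * cnj (e l))"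
        using ij by (simp add: B')
      then show "B $$ (i, l) * cnj (B $$ (j, l)) = d i * cnj (d j) *
          (W $$ (\<sigma> i, \<tau> l) * cnj (W $$ (\<sigma> j, \<tau> l)))"
        using eT by simp
    qed simp
    also have "\<dots> = d i * cnj (d j) * (\<Sum>l<n. W $$ (\<sigma> i, \<tau> l) * cnj (W $$ (\<sigma> j, \<tau> l)))"
      by (simp add: sum_distrib_left)
    also have "(\<Sum>l<n. W $$ (\<sigma> i, \<tau> l) * cnj (W $$ (\<sigma> j, \<tau> l))) =
        (\<Sum>l<n. W $$ (\<sigma> i, l) * cnj (W $$ (\<sigma> j, l)))"
      by (rule sum.reindex_bij_betw[OF permutes_imp_bij[OF *(2)]])
    also have "\<dots> = (W * mat_adjoint W) $$ (\<sigma> i, \<sigma> j)"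
      using ij * by (simp add: mult_mat_adjoint_index[OF W_c] permutes_lessThan)
    also have "\<dots> = (if i = j then w else 0)"
      using ij * permutes_inj[OF *(1)] by (auto simp: WW permutes_lessThan dest: injD)
    also have "d i * cnj (d j) * (if i = j then w else 0) = (w \<cdot>\<^sub>m 1\<^sub>m n) $$ (i, j)"
      using ij dT by auto
    finally show "(B * mat_adjoint B) $$ (i, j) = (w \<cdot>\<^sub>m 1\<^sub>m n) $$ (i, j)" .
  qed (auto simp: B' mat_adjoint_def)
  then show ?thesis
    using mat_orbit_T0_mat[OF T0W B] by (simp add: unit_weighing_mat_def)
qed

section \<open>Row-major minima in the orbit\<close>

definition agree_before :: "nat \<Rightarrow> nat \<Rightarrow> nat \<Rightarrow> complex mat \<Rightarrow> complex mat \<Rightarrow> bool" where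
  "agree_before n i j A B \<longleftrightarrow>
     (\<forall>k l. l < n \<and> (k < i \<or> k = i \<and> l < j) \<longrightarrow> A $$ (k, l) = B $$ (k, l))"

text \<open>Numbering position \<open>(k, l)\<close> as \<open>k * n + l\<close> turns matrices into
  sequences, to which \<open>lexicographic_min_exists\<close> applies.\<close>

lemma agree_before_iff_row_major:
  assumes "p < m * n"
  shows "agree_before n (p div n) (p mod n) A B \<longleftrightarrow>
    (\<forall>q<p. A $$ (q div n, q mod n) = B $$ (q div n, q mod n))"
proof -
  have n: "n > 0" using assms by (cases n) auto
  have before: "q < p \<longleftrightarrow> q div n < p div n \<or> q div n = p div n \<and> q mod n < p mod n" for q
  proof
    assume "q < p"
    moreover have "q div n \<le> p div n" using \<open>q < p\<close> by (simp add: div_le_mono)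
    ultimately show "q div n < p div n \<or> q div n = p div n \<and> q mod n < p mod n"
      by (metis div_mult_mod_eq le_neq_implies_less nat_add_left_cancel_less)
  next
    assume "q div n < p div n \<or> q div n = p div n \<and> q mod n < p mod n"
    then show "q < p"
      by (metis div_le_mono div_mult_mod_eq linorder_not_le nat_add_left_cancel_less)
  qed
  show ?thesis
  proof
    assume "agree_before n (p div n) (p mod n) A B"
    then show "\<forall>q<p. A $$ (q div n, q mod n) = B $$ (q div n, q mod n)"
      using before n by (simp add: agree_before_def)
  next
    assume *: "\<forall>q<p. A $$ (q div n, q mod n) = B $$ (q div n, q mod n)"
    show "agree_before n (p div n) (p mod n) A B"
      unfolding agree_before_def
    proof (intro allI impI)
      fix k l assume kl: "l < n \<and> (k < p div n \<or> k = p div n \<and> l < p mod n)"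
      then have "k * n + l < p" using before[of "k * n + l"] by simp
      with * kl show "A $$ (k, l) = B $$ (k, l)" by (auto dest!: spec[of _ "k * n + l"])
    qed
  qed
qed

text \<open>If \<open>d\<close>, \<open>e\<close> fix all entries before position \<open>(i, j)\<close> but not the one at \<open>(i, j)\<close>, then
  replacing \<open>d\<close> and \<open>cnj \<circ> e\<close> by their compositions with any function \<open>T \<rightarrow> T\<close> still fixes the
  earlier entries. A function separating \<open>d i\<close> from \<open>cnj (e j)\<close> rotates entry \<open>(i, j)\<close> to 1.\<close>

lemma scaling_to_one:
  assumes B: "B \<in> T0_mat m n" and ij: "i < m" "j < n"
    and de: "range d \<subseteq> T" "range e \<subseteq> T"
    and agree: "agree_before n i j (scaled_perm_mat m n B id id d e) B"
    and neq: "scaled_perm_mat m n B id id d e $$ (i, j) \<noteq> B $$ (i, j)"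
  shows "\<exists>d' e'. range d' \<subseteq> T \<and> range e' \<subseteq> T \<and>
    agree_before n i j (scaled_perm_mat m n B id id d' e') B \<and>
    scaled_perm_mat m n B id id d' e' $$ (i, j) = 1"
proof -
  have dT: "d k \<in> T" and eT: "e k \<in> T" for k using de by auto
  let ?z = "B $$ (i, j)"
  have "?z \<noteq> 0" using neq ij by auto
  then have z: "?z \<in> T" using B ij by (auto simp: T0_mat_iff dest: T0_cases)
  \<comment> \<open>The separating function \<open>g\<close> sends \<open>d i\<close> to
    \<open>cnj ?z\<close> and everything else to 1. Then \<open>d'\<close> is \<open>g\<close> after
    \<open>d\<close>, and \<open>e'\<close> is the conjugate of \<open>g\<close> applied to
    \<open>cnj (e l)\<close>: for units, \<open>d i * e l = 1\<close> says that
    \<open>cnj (e l)\<close> equals \<open>d i\<close>.\<close>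
  define d' where "d' k = (if d k = d i then cnj ?z else 1)" for k
  define e' where "e' l = (if d i * e l = 1 then ?z else 1)" for l
  have "d i * e j \<noteq> 1" using neq ij by (auto simp: algebra_simps)
  then have "scaled_perm_mat m n B id id d' e' $$ (i, j) = 1"
    using ij z by (simp add: d'_def e'_def)
  moreover have "agree_before n i j (scaled_perm_mat m n B id id d' e') B"
    unfolding agree_before_def
  proof (intro allI impI)
    fix k l assume kl: "l < n \<and> (k < i \<or> k = i \<and> l < j)"
    then have "k < m" using ij by auto
    have eq: "d k * B $$ (k, l) * e l = B $$ (k, l)"
    proof -
      have "scaled_perm_mat m n B id id d e $$ (k, l) = B $$ (k, l)"
        using agree kl unfolding agree_before_def by blast
      then show ?thesis using kl \<open>k < m\<close> by simp
    qed
    show "scaled_perm_mat m n B id id d' e' $$ (k, l) = B $$ (k, l)"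
    proof (cases "B $$ (k, l) = 0")
      case True
      then show ?thesis using kl \<open>k < m\<close> by simp
    next
      case False
      have "(d k * e l) * B $$ (k, l) = 1 * B $$ (k, l)"
        using eq by (simp add: algebra_simps)
      then have 1: "d k * e l = 1"
        using False mult_cancel_right by blast
      \<comment> \<open>Hence the two new factors are either \<open>cnj ?z\<close> and
        \<open>?z\<close>, or both 1, and they cancel in each case.\<close>
      then have "d k = d i \<longleftrightarrow> d i * e l = 1"
        using T_nonzero[OF eT[of l]] by (metis mult_cancel_right)
      then have "d' k * e' l = 1"
        using z by (simp add: d'_def e'_def)
      then have "d' k * B $$ (k, l) * e' l = B $$ (k, l)"
        by (metis mult.assoc mult.commute mult_1)
      then show ?thesis using kl \<open>k < m\<close> by simp
    qed
  qed
  moreover have "range d' \<subseteq> T" "range e' \<subseteq> T"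
    using z by (auto simp: d'_def e'_def)
  ultimately show ?thesis by blast
qed

text \<open>Quotients of scalars do it, the inverse of a unit being its conjugate. Orbit elements
  with the same permutations thus differ by a pure rescaling, the situation of
  \<open>scaling_to_one\<close>.\<close>

lemma same_perm_scaled_relation:
  assumes "range d \<subseteq> T" "range e \<subseteq> T" "range d' \<subseteq> T" "range e' \<subseteq> T"
  shows "\<exists>d'' e''. range d'' \<subseteq> T \<and> range e'' \<subseteq> T \<and> scaled_perm_mat m n A \<sigma> \<tau> d' e' =
    scaled_perm_mat m n (scaled_perm_mat m n A \<sigma> \<tau> d e) id id d'' e''"
proof (intro exI conjI)
  have T: "d k \<in> T" "e k \<in> T" "d' k \<in> T" "e' k \<in> T" for k using assms by auto
  show "range (\<lambda>k. d' k * cnj (d k)) \<subseteq> T" "range (\<lambda>k. e' k * cnj (e k)) \<subseteq> T"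
    using T by auto
  show "scaled_perm_mat m n A \<sigma> \<tau> d' e' =
    scaled_perm_mat m n (scaled_perm_mat m n A \<sigma> \<tau> d e) id id
      (\<lambda>k. d' k * cnj (d k)) (\<lambda>k. e' k * cnj (e k))"
  proof (rule eq_matI, goal_cases)
    case (1 i j)
    have "d' i * cnj (d i) * (d i * A $$ (\<sigma> i, \<tau> j) * e j) * (e' j * cnj (e j)) =
      (cnj (d i) * d i) * (cnj (e j) * e j) * (d' i * A $$ (\<sigma> i, \<tau> j) * e' j)"
      by (simp add: algebra_simps)
    then show ?case using 1 T by simp
  qed auto
qed

text \<open>This supplies the \<open>step\<close> hypothesis of
  \<open>lexicographic_min_exists\<close>. Here \<open>V\<close> collects the values attainable at
  \<open>(i, j)\<close> once the entries before it are fixed as in \<open>B\<close>.\<close>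

lemma orbit_entry_least:
  assumes r: "strict_linear_order_on T0 r" and r1: "\<forall>z\<in>T0. z \<noteq> 1 \<longrightarrow> (1, z) \<in> r"
    and A: "A \<in> T0_mat m n" and B: "B \<in> mat_orbit m n A" and ij: "i < m" "j < n"
  shows "\<exists>C\<in>mat_orbit m n A. agree_before n i j C B \<and>
    (\<forall>Z\<in>mat_orbit m n A. agree_before n i j Z B \<longrightarrow>
       C $$ (i, j) = Z $$ (i, j) \<or> (C $$ (i, j), Z $$ (i, j)) \<in> r)"
proof -
  define X where "X = {Z \<in> mat_orbit m n A. agree_before n i j Z B}"
  define V where "V = (\<lambda>Z. Z $$ (i, j)) ` X"
  have "B \<in> X" using B by (simp add: X_def agree_before_def)
  then have "V \<noteq> {}" by (auto simp: V_def)
  have V_T0: "V \<subseteq> T0"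
  proof
    fix v assume "v \<in> V"
    then obtain Z where Z: "Z \<in> mat_orbit m n A" "v = Z $$ (i, j)"
      by (auto simp: V_def X_def)
    show "v \<in> T0"
      using mat_orbit_T0_mat[OF A Z(1)] ij Z(2) by (simp add: T0_mat_iff)
  qed
  have "\<exists>v\<in>V. \<forall>x\<in>V. v = x \<or> (v, x) \<in> r"
  proof (cases "1 \<in> V")
    case True
    moreover have "1 = x \<or> (1, x) \<in> r" if "x \<in> V" for x
      using r1 subsetD[OF V_T0 that] by auto
    ultimately show ?thesis by (intro bexI[of _ 1] ballI)
  next
    case no1: False
    define Y where "Y \<sigma> \<tau> = {scaled_perm_mat m n A \<sigma> \<tau> d e | d e. range d \<subseteq> T \<and> range e \<subseteq> T} \<inter> X"
      for \<sigma> \<tau>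
    let ?I = "{\<sigma>. \<sigma> permutes {..<m}} \<times> {\<tau>. \<tau> permutes {..<n}}"
    have "X = (\<Union>(\<sigma>, \<tau>)\<in>?I. Y \<sigma> \<tau>)"
    proof
      show "X \<subseteq> (\<Union>(\<sigma>, \<tau>)\<in>?I. Y \<sigma> \<tau>)"
      proof
        fix Z assume Z: "Z \<in> X"
        then obtain \<sigma> \<tau> d e where "Z = scaled_perm_mat m n A \<sigma> \<tau> d e"
          and perm: "\<sigma> permutes {..<m}" "\<tau> permutes {..<n}" and "range d \<subseteq> T" "range e \<subseteq> T"
          unfolding X_def mat_orbit_def by blast
        then have "Z \<in> Y \<sigma> \<tau>" using Z unfolding Y_def by blast
        then show "Z \<in> (\<Union>(\<sigma>, \<tau>)\<in>?I. Y \<sigma> \<tau>)" using perm by auto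
      qed
    qed (auto simp: Y_def)
    then have "V = (\<Union>(\<sigma>, \<tau>)\<in>?I. (\<lambda>Z. Z $$ (i, j)) ` Y \<sigma> \<tau>)"
      unfolding V_def by auto
    moreover have "finite ((\<lambda>Z. Z $$ (i, j)) ` Y \<sigma> \<tau>)"
      if perm: "\<sigma> permutes {..<m}" "\<tau> permutes {..<n}" for \<sigma> \<tau>
    proof -
      \<comment> \<open>Two values for one pair of permutations would come from matrices differing
        by a rescaling that fixes the earlier entries but not this one;
        \<open>scaling_to_one\<close> would then attain 1, contrary to \<open>no1\<close>.\<close>
      have eq: "Z $$ (i, j) = Z' $$ (i, j)" if ZY: "Z \<in> Y \<sigma> \<tau>" "Z' \<in> Y \<sigma> \<tau>" for Z Z'
      proof (rule ccontr)
        assume neq: "Z $$ (i, j) \<noteq> Z' $$ (i, j)"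
        have ZX: "Z \<in> X" "Z' \<in> X" using ZY by (auto simp: Y_def)
        obtain d e where de: "range d \<subseteq> T" "range e \<subseteq> T" "Z' = scaled_perm_mat m n Z id id d e"
        proof -
          obtain d1 e1 d2 e2 where "range d1 \<subseteq> T" "range e1 \<subseteq> T" "range d2 \<subseteq> T" "range e2 \<subseteq> T"
            and Z: "Z = scaled_perm_mat m n A \<sigma> \<tau> d1 e1" "Z' = scaled_perm_mat m n A \<sigma> \<tau> d2 e2"
            using ZY unfolding Y_def by blast
          from same_perm_scaled_relation[OF this(1-4), of m n A \<sigma> \<tau>, folded Z]
          show ?thesis using that by blast
        qed
        have "agree_before n i j Z' Z"
          using ZX by (auto simp: X_def agree_before_def)
        then obtain d' e' where *: "range d' \<subseteq> T" "range e' \<subseteq> T"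
          "agree_before n i j (scaled_perm_mat m n Z id id d' e') Z"
          "scaled_perm_mat m n Z id id d' e' $$ (i, j) = 1"
          using scaling_to_one[OF mat_orbit_T0_mat[OF A] ij de(1,2), of Z] neq ZX(1) de(3)
          by (auto simp: X_def)
        \<comment> \<open>It agrees with \<open>Z\<close> before \<open>(i, j)\<close>, and
          \<open>Z\<close> agrees with \<open>B\<close> there.\<close>
        have "scaled_perm_mat m n Z id id d' e' \<in> X"
          using * ZX(1) by (auto simp: X_def agree_before_def permutes_id
              intro!: mat_orbit_scaled_perm_mat)
        then have "1 \<in> V" using *(4) by (force simp: V_def)
        then show False using no1 by simp
      qed
      show ?thesis
      proof (cases "Y \<sigma> \<tau> = {}")
        case False
        then obtain Z where "Z \<in> Y \<sigma> \<tau>" by auto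
        then have "(\<lambda>Z. Z $$ (i, j)) ` Y \<sigma> \<tau> \<subseteq> {Z $$ (i, j)}" using eq by blast
        then show ?thesis by (rule finite_subset) simp
      qed simp
    qed
    ultimately have "finite V"
      by (auto simp: finite_permutations)
    then show ?thesis
      using finite_strict_linear_order_least[OF r] \<open>V \<noteq> {}\<close> V_T0 by simp
  qed
  then obtain C where "C \<in> X" "\<forall>x\<in>V. C $$ (i, j) = x \<or> (C $$ (i, j), x) \<in> r"
    unfolding V_def by blast
  then show ?thesis unfolding V_def X_def by blast
qed

text \<open>Minimality is phrased as the absence of a strictly smaller competitor, the form that a
  defect of the matrix contradicts directly. Asymmetry of \<open>r\<close> yields it from the weak
  comparison.\<close>

lemma orbit_row_major_min_exists:
  assumes r: "strict_linear_order_on T0 r" and r1: "\<forall>z\<in>T0. z \<noteq> 1 \<longrightarrow> (1, z) \<in> r"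
    and A: "A \<in> T0_mat m n"
  shows "\<exists>B\<in>mat_orbit m n A. \<forall>i<m. \<forall>j<n. \<forall>Z\<in>mat_orbit m n A.
    agree_before n i j Z B \<longrightarrow> (Z $$ (i, j), B $$ (i, j)) \<notin> r"
proof -
  let ?f = "\<lambda>B p. B $$ (p div n, p mod n) :: complex"
  have bounds: "p div n < m" "p mod n < n" if "p < m * n" for p
    using that by (auto simp: less_mult_imp_div_less intro!: mod_less_divisor, cases n, auto)
  have "mat_orbit m n A \<noteq> {}" using A mat_orbit_refl[of A m n] by (auto simp: T0_mat_iff)
  then have "\<exists>B\<in>mat_orbit m n A. \<forall>p<m * n. \<forall>Z\<in>mat_orbit m n A.
      (\<forall>q<p. ?f Z q = ?f B q) \<longrightarrow> ?f B p = ?f Z p \<or> (?f B p, ?f Z p) \<in> r"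
  proof (rule lexicographic_min_exists)
    fix p B assume "p < m * n" "B \<in> mat_orbit m n A"
    then show "\<exists>C\<in>mat_orbit m n A. (\<forall>q<p. ?f C q = ?f B q) \<and> (\<forall>Z\<in>mat_orbit m n A.
        (\<forall>q<p. ?f Z q = ?f B q) \<longrightarrow> ?f C p = ?f Z p \<or> (?f C p, ?f Z p) \<in> r)"
      using orbit_entry_least[OF r r1 A, of B "p div n" "p mod n"] bounds
        agree_before_iff_row_major by simp
  qed
  then obtain B where B: "B \<in> mat_orbit m n A"
    and min: "\<And>p Z. p < m * n \<Longrightarrow> Z \<in> mat_orbit m n A \<Longrightarrow>
      agree_before n (p div n) (p mod n) Z B \<Longrightarrow> ?f B p = ?f Z p \<or> (?f B p, ?f Z p) \<in> r"
    using agree_before_iff_row_major by metis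
  have "(Z $$ (i, j), B $$ (i, j)) \<notin> r"
    if "i < m" "j < n" "Z \<in> mat_orbit m n A" "agree_before n i j Z B" for i j Z
  proof -
    have "i * n + j < m * n"
      using that(1,2) by (metis add_strict_left_mono[of j n "i * n"] mult_Suc add.commute
          less_le_trans mult_le_mono1 Suc_leI)
    moreover have "(i * n + j) div n = i" "(i * n + j) mod n = j" using that(2) by auto
    ultimately have "B $$ (i, j) = Z $$ (i, j) \<or> (B $$ (i, j), Z $$ (i, j)) \<in> r"
      using min[of "i * n + j" Z] that by simp
    moreover have "irrefl r" "trans r" using r by (auto simp: strict_linear_order_on_def)
    ultimately show ?thesis by (metis irreflD transD)
  qed
  then show ?thesis using B by blast
qed

section \<open>Standard form of a row-major minimum\<close>

lemma vec_first_difference: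
  assumes "a \<noteq> b" "dim_vec a = dim_vec b"
  shows "\<exists>k<dim_vec a. (\<forall>j<k. a $ j = b $ j) \<and> a $ k \<noteq> b $ k"
proof -
  let ?P = "\<lambda>k. k < dim_vec a \<and> a $ k \<noteq> b $ k"
  have "\<exists>k. ?P k" using assms by (metis eq_vecI)
  then have least: "?P (LEAST k. ?P k)" by (rule LeastI_ex)
  have "a $ j = b $ j" if "j < (LEAST k. ?P k)" for j
    using not_less_Least[OF that] less_trans[OF that] least by blast
  then show ?thesis using least by blast
qed

lemma row_major_min_standard_form:
  assumes r: "strict_linear_order_on T0 r" and r1: "\<forall>z\<in>T0. z \<noteq> 1 \<longrightarrow> (1, z) \<in> r"
    and A: "A \<in> T0_mat m n" and B: "B \<in> mat_orbit m n A"
    and min: "\<And>i j Z. i < m \<Longrightarrow> j < n \<Longrightarrow> Z \<in> mat_orbit m n A \<Longrightarrow> agree_before n i j Z B \<Longrightarrow>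
      (Z $$ (i, j), B $$ (i, j)) \<notin> r"
  shows "standard_form r m n B"
proof -
  have BT: "B \<in> T0_mat m n" using mat_orbit_T0_mat[OF A B] .
  then have dim [simp]: "dim_row B = m" "dim_col B = n" and
    ent: "\<And>i j. i < m \<Longrightarrow> j < n \<Longrightarrow> B $$ (i, j) \<in> T0"
    by (auto simp: T0_mat_iff)
  \<comment> \<open>The row, column and first-row conditions all use this special case: a competitor
    showing 1 at the position forces 1 in \<open>B\<close>. Only the row ordering needs
    \<open>min\<close> in full.\<close>
  have is1: "B $$ (i, j) = 1"
    if "i < m" "j < n" "Z \<in> mat_orbit m n A" "agree_before n i j Z B" "Z $$ (i, j) = 1" for i j Z
  proof (rule ccontr)
    assume "B $$ (i, j) \<noteq> 1"
    then have "(1, B $$ (i, j)) \<in> r" using r1 ent[OF that(1,2)] by blast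
    then show False using min[OF that(1-4)] that(5) by simp
  qed
  have S1: "first_nonzero_one (row B i)" if i: "i < m" for i
    unfolding first_nonzero_one_def
  proof (intro allI impI)
    fix k assume "k < dim_vec (row B i)"
      and "row B i $ k \<noteq> 0 \<and> (\<forall>j<k. row B i $ j = 0)"
    then have k: "k < n" "B $$ (i, k) \<noteq> 0" "\<And>j. j < k \<Longrightarrow> B $$ (i, j) = 0"
      using i by auto
    let ?c = "B $$ (i, k)"
    have c: "?c \<in> T" using T0_cases[OF ent] i k by blast
    \<comment> \<open>Scaling row \<open>i\<close> leaves the rows above alone, and its entries left
      of column \<open>k\<close> are zero.\<close>
    let ?Z = "scaled_perm_mat m n B id id (\<lambda>l. if l = i then cnj ?c else 1) (\<lambda>_. 1)"
    have "?Z \<in> mat_orbit m n A"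
      using c by (intro mat_orbit_scaled_perm_mat[OF B permutes_id permutes_id]) auto
    moreover have "agree_before n i k ?Z B"
      using i k by (auto simp: agree_before_def)
    moreover have "?Z $$ (i, k) = 1" using i k c by simp
    ultimately have "B $$ (i, k) = 1" by (rule is1[OF i k(1)])
    then show "row B i $ k = 1" using i k by simp
  qed
  have S2: "first_nonzero_one (col B j)" if j: "j < n" for j
    unfolding first_nonzero_one_def
  proof (intro allI impI)
    fix k assume "k < dim_vec (col B j)"
      and "col B j $ k \<noteq> 0 \<and> (\<forall>i<k. col B j $ i = 0)"
    then have k: "k < m" "B $$ (k, j) \<noteq> 0" "\<And>i. i < k \<Longrightarrow> B $$ (i, j) = 0"
      using j by auto
    let ?c = "B $$ (k, j)"
    have c: "?c \<in> T" using T0_cases[OF ent] j k by blast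
    \<comment> \<open>Scaling column \<open>j\<close> changes nothing before \<open>(k, j)\<close>:
      above row \<open>k\<close> the column is zero, and the entries to the left lie in other
      columns.\<close>
    let ?Z = "scaled_perm_mat m n B id id (\<lambda>_. 1) (\<lambda>l. if l = j then cnj ?c else 1)"
    have "?Z \<in> mat_orbit m n A"
      using c by (intro mat_orbit_scaled_perm_mat[OF B permutes_id permutes_id]) auto
    moreover have "agree_before n k j ?Z B"
      using j k by (auto simp: agree_before_def)
    moreover have "?Z $$ (k, j) = 1" using j k c by simp
    ultimately have "B $$ (k, j) = 1" by (rule is1[OF k(1) j])
    then show "col B j $ k = 1" using j k by simp
  qed
  have S3: "ones_then_zeros (row B 0)" if m: "0 < m"
  proof -
    \<comment> \<open>A non-zero entry in the top row is the first non-zero entry of its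
      column.\<close>
    have one: "B $$ (0, j) = 1" if "j < n" "B $$ (0, j) \<noteq> 0" for j
      using S2[OF that(1)] that m by (auto simp: first_nonzero_one_def)
    have zeros: "B $$ (0, l) = 0" if "j < l" "l < n" "B $$ (0, j) = 0" for j l
    proof (rule ccontr)
      assume nz: "B $$ (0, l) \<noteq> 0"
      \<comment> \<open>Only the top row precedes \<open>(0, j)\<close>, and there the swap touches
        no column left of \<open>j\<close>; it brings the 1 from column \<open>l\<close>
        forward.\<close>
      let ?Z = "scaled_perm_mat m n B id (transpose j l) (\<lambda>_. 1) (\<lambda>_. 1)"
      have "?Z \<in> mat_orbit m n A"
        using that by (intro mat_orbit_scaled_perm_mat[OF B permutes_id permutes_swap_id]) auto
      moreover have "agree_before n 0 j ?Z B"
        using m that by (auto simp: agree_before_def transpose_def)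
      moreover have "?Z $$ (0, j) = 1" using m that one nz by simp
      ultimately show False using is1[of 0 j ?Z] m that by simp
    qed
    \<comment> \<open>The alternative \<open>k = n\<close> covers a top row without zeros.\<close>
    define k where "k = (LEAST k. k = n \<or> B $$ (0, k) = 0)"
    have k: "k = n \<or> B $$ (0, k) = 0" unfolding k_def by (rule LeastI[of _ n]) simp
    have "k \<le> n" unfolding k_def by (rule Least_le) simp
    have "B $$ (0, j) = (if j < k then 1 else 0)" if "j < n" for j
    proof (cases "j < k")
      case True
      then show ?thesis using not_less_Least[of j] one that by (auto simp: k_def)
    next
      case False
      then show ?thesis using k zeros[of k j] that by (cases "j = k") auto
    qed
    then show ?thesis
      unfolding ones_then_zeros_def using \<open>k \<le> n\<close> m by (intro exI[of _ k]) auto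
  qed
  have S4: "lex_le r (row B i) (row B (Suc i))" if i: "Suc i < m" for i
  proof (cases "row B i = row B (Suc i)")
    case False
    then obtain k where k: "k < n" "\<forall>j<k. row B i $ j = row B (Suc i) $ j"
      "row B i $ k \<noteq> row B (Suc i) $ k"
      using vec_first_difference[OF False] by auto
    \<comment> \<open>The swap moves row \<open>Suc i\<close> into row \<open>i\<close>; the two
      agree left of \<open>k\<close>, so the first change in row-major order is at
      \<open>(i, k)\<close>.\<close>
    let ?Z = "scaled_perm_mat m n B (transpose i (Suc i)) id (\<lambda>_. 1) (\<lambda>_. 1)"
    have "?Z \<in> mat_orbit m n A"
      using i by (intro mat_orbit_scaled_perm_mat[OF B permutes_swap_id permutes_id]) auto
    moreover have "agree_before n i k ?Z B"
      using i k by (auto simp: agree_before_def transpose_def)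
    ultimately have "(?Z $$ (i, k), B $$ (i, k)) \<notin> r" using i by (intro min[OF _ k(1)]) simp_all
    then have "(B $$ (Suc i, k), B $$ (i, k)) \<notin> r" using i k by simp
    moreover have "total_on T0 r" using r by (simp add: strict_linear_order_on_def)
    ultimately have "(B $$ (i, k), B $$ (Suc i, k)) \<in> r"
      using ent[of i k] ent[of "Suc i" k] i k unfolding total_on_def by (metis Suc_lessD index_row(1) dim)
    then show ?thesis using i k by (auto simp: lex_le_def lex_less_def)
  qed (simp add: lex_le_def)
  show ?thesis unfolding standard_form_def using BT S1 S2 S3 S4 by blast
qed

theorem corollary2p4:
  fixes r :: "complex rel" and n :: nat and w :: complex and W :: "complex mat"
  assumes "strict_linear_order_on T0 r"
    and "\<forall>z \<in> T0. z \<noteq> 1 \<longrightarrow> (1, z) \<in> r"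
    and "\<forall>z \<in> T0. z \<noteq> 0 \<longrightarrow> (z, 0) \<in> r"
    and "n \<ge> 1"
    and "unit_weighing_mat n w W"
  shows "\<exists>w' S. unit_weighing_mat n w' S \<and> equivalent_mats n n W S \<and> standard_form r n n S"
proof -
  have W: "W \<in> T0_mat n n" using assms(5) by (simp add: unit_weighing_mat_def)
  obtain S where "S \<in> mat_orbit n n W"
    and "\<forall>i<n. \<forall>j<n. \<forall>Z\<in>mat_orbit n n W.
      agree_before n i j Z S \<longrightarrow> (Z $$ (i, j), S $$ (i, j)) \<notin> r"
    using orbit_row_major_min_exists[OF assms(1,2) W] by blast
  then have "unit_weighing_mat n w S" "equivalent_mats n n W S" "standard_form r n n S"
    using mat_orbit_unit_weighing[OF assms(5)] mat_orbit_equivalent[OF W]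
      row_major_min_standard_form[OF assms(1,2) W] by simp_all
  then show ?thesis by blast
qed

end
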